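(* Let $\mathcal{X}=[0,1]$ and let $K$ be a bounded subset of $\mathbb{R}$. Let $f_0:\mathcal{X}\to K$ be a weakly increasing measurable function (the target), and let $\hat f:\mathcal{X}\to K$ be another measurable function (an initial estimate of $f_0$). Let $\hat f^*$ be the increasing rearrangement of $\hat f$. 1. For any $p\in[1,\infty]$, $$\left\{\int_{\mathcal{X}}\left|\hat f^*(x)-f_0(x)\right|^p dx\right\}^{1/p}\le\left\{\int_{\mathcal{X}}\left|\hat f(x)-f_0(x)\right|^p dx\right\}^{1/p}.$$ 2. Suppose that there exist $\delta>0$, $\epsilon>0$ and measurable sets $\mathcal{X}_0,\mathcal{X}_0'\subset\mathcal{X}$, each of Lebesgue measure greater than $\delta$, such that for all $x\in\mathcal{X}_0$ and $x'\in\mathcal{X}_0'$: (i) $x'>x$, (ii) $\hat f(x)>\hat f(x')+\epsilon$, and (iii) $f_0(x')>f_0(x)+\epsilon$. Then for any $p\in(1,\infty)$, $$\left\{\int_{\mathcal{X}}\left|\hat f^*(x)-f_0(x)\right|^p dx\right\}^{1/p}\le\left\{\int_{\mathcal{X}}\left|\hat f(x)-f_0(x)\right|^p dx-\delta\,\eta_p\right\}^{1/p},$$ where $$\eta_p=\inf\left\{|v-t'|^p+|v'-t|^p-|v-t|^p-|v'-t'|^p\right\}>0,$$ the infimum being taken over all $v,v',t,t'\in K$ such that $v'\ge v+\epsilon$ and $t'\ge t+\epsilon$ (the positivity of $\eta_p$ is part of the assertion).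
   Context: For a measurable function $f:[0,1]\to K$, with $K\subset\mathbb{R}$ bounded, the increasing rearrangement $f^*$ of $f$ is the quantile function of the random variable $f(X)$ with $X\sim U(0,1)$: $$f^*(x)=\inf\left\{y\in\mathbb{R}:\int_0^1 1\{f(u)\le y\}\,du\ge x\right\},\qquad x\in[0,1].$$ Convention: at $x=0$ the infimum is $-\infty$, so $f^*$ is read as an extended-real-valued function; it is finite on $(0,1]$, and the single point $x=0$ does not affect integrals. For $p=\infty$, the expression $\{\int|g|^p\}^{1/p}$ denotes the essential supremum of $|g|$ with respect to Lebesgue measure. "Weakly increasing" means nondecreasing. *)

theory Defs
  imports "HOL-Analysis.Analysis" "HOL-Probability.Essential_Supremum"
begin

text \<open>The unit interval carries Lebesgue measure on its Lebesgue measurable subsets, so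
  ``measurable'' means Lebesgue measurable throughout; this includes the Borel functions.\<close>

abbreviation unit_leb :: "real measure" where
  "unit_leb \<equiv> lebesgue_on {0..1}"

text \<open>The infimum is taken over real levels \<open>y\<close>, but its value lies in \<^typ>\<open>ereal\<close>:
  at \<open>x = 0\<close> every level qualifies and the value is \<open>-\<infinity>\<close>.\<close>

definition increasing_rearrangement :: "(real \<Rightarrow> real) \<Rightarrow> real \<Rightarrow> ereal" where
  "increasing_rearrangement f x =
     (INF y \<in> {y::real. (LINT u|unit_leb. indicat_real {u. f u \<le> y} u) \<ge> x}. ereal y)"

text \<open>Real-valued version for use under integrals. By \<open>increasing_rearrangement_finite\<close> below,
  \<^const>\<open>real_of_ereal\<close> changes the value (from \<open>-\<infinity>\<close> to \<open>0\<close>) only at the null point \<open>x = 0\<close>.\<close>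

definition real_rearrangement :: "(real \<Rightarrow> real) \<Rightarrow> real \<Rightarrow> real" where
  "real_rearrangement f x = real_of_ereal (increasing_rearrangement f x)"

text \<open>In the case \<open>p = \<infinity>\<close>, \<^const>\<open>esssup\<close> needs a complete order, hence the
  embedding into \<^typ>\<open>ereal\<close>.\<close>

definition Lp_norm :: "ereal \<Rightarrow> (real \<Rightarrow> real) \<Rightarrow> ereal" where
  "Lp_norm p g =
     (if p = \<infinity> then esssup unit_leb (\<lambda>x. ereal \<bar>g x\<bar>)
      else ereal ((LINT x|unit_leb. \<bar>g x\<bar> powr real_of_ereal p) powr (1 / real_of_ereal p)))"

definition eta :: "real set \<Rightarrow> real \<Rightarrow> real \<Rightarrow> real" where
  "eta K \<epsilon> p =
     Inf {\<bar>v - t'\<bar> powr p + \<bar>v' - t\<bar> powr p - \<bar>v - t\<bar> powr p - \<bar>v' - t'\<bar> powr p | v v' t t'.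
            v \<in> K \<and> v' \<in> K \<and> t \<in> K \<and> t' \<in> K \<and> v' \<ge> v + \<epsilon> \<and> t' \<ge> t + \<epsilon>}"

lemma increasing_rearrangement_finite:
  assumes "bounded K" "f \<in> {0..1} \<rightarrow> K" "0 < x" "x \<le> 1"
  shows "\<bar>increasing_rearrangement f x\<bar> \<noteq> \<infinity>"
proof -
  from assms(1) obtain B where B: "\<And>k. k \<in> K \<Longrightarrow> \<bar>k\<bar> \<le> B"
    by (auto simp: bounded_real)
  have fB: "\<bar>f u\<bar> \<le> B" if "u \<in> {0..1}" for u
    using assms(2) that by (intro B) auto
  have "(LINT u|unit_leb. indicat_real {u. f u \<le> B} u) = (LINT u|unit_leb. 1)"
    using fB by (intro Bochner_Integration.integral_cong) (fastforce simp: indicator_def)+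
  also have "\<dots> = 1"
    by (simp add: measure_restrict_space)
  finally have up: "increasing_rearrangement f x \<le> ereal B"
    unfolding increasing_rearrangement_def using assms(4) by (intro INF_lower) auto
  have "- B \<le> y" if "(LINT u|unit_leb. indicat_real {u. f u \<le> y} u) \<ge> x" for y
  proof (rule ccontr)
    assume y: "\<not> - B \<le> y"
    have "(LINT u|unit_leb. indicat_real {u. f u \<le> y} u) = (LINT u|unit_leb. 0)"
      using fB y by (intro Bochner_Integration.integral_cong) (fastforce simp: indicator_def)+
    with that assms(3) show False by simp
  qed
  then have "ereal (- B) \<le> increasing_rearrangement f x"
    unfolding increasing_rearrangement_def by (intro INF_greatest) auto
  with up show ?thesis
    by (cases "increasing_rearrangement f x") auto
qed

end

theory Submission
  imports Defs "HOL-Probability.Distribution_Functions"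
begin

text \<open>Let \<open>\<phi>\<close> be convex with nondecreasing derivative \<open>g\<close>. Since
  \<open>\<phi> (v - t) = \<phi> (-B - t) + \<integral>\<^bsub>-B\<^esub>\<^bsup>v\<^esup> g (s - t) ds\<close>, Fubini's theorem writes
  \<open>\<integral> \<phi> (f - f0)\<close>, up to a term independent of \<open>f\<close>, as the integral over the levels \<open>s\<close> of
  \<open>\<integral> g (s - f0 x) 1{s < f x} dx\<close>. Here \<open>g (s - f0 x)\<close> is decreasing in \<open>x\<close>, and the superlevel set
  of the rearrangement is, up to a null set, the right end of the unit interval of the same
  measure as \<open>{f > s}\<close>; by the bathtub principle it minimises the inner integral among all weights
  of that mass, for every \<open>s\<close> separately. The cost \<open>|u|\<^sup>p\<close> gives finite \<open>p\<close>, and the costs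
  \<open>max (|u| - r) 0\<close> give \<open>p = \<infinity>\<close>.

  For the improved bound let \<open>b = sup f\<close> and \<open>d = inf f0\<close> on \<open>X0'\<close>, \<open>a = inf f\<close> and
  \<open>c = sup f0\<close> on \<open>X0\<close>. For levels \<open>b \<le> s < a\<close> compare with the weight that moves mass \<open>\<delta>\<close> of the
  superlevel set from \<open>X0\<close> to \<open>X0'\<close>: this gains \<open>\<delta> (g (s - c) - g (s - d))\<close>, whose integral over
  \<open>s\<close> is \<open>\<delta>\<close> times the expression minimised in \<open>\<eta>\<close> at a point of the closure of its
  constraint set.\<close>

section \<open>Lebesgue measure on the unit interval as a probability space\<close>

lemma finite_measure_lebesgue_on_Icc: "finite_measure (lebesgue_on {a..b::real})"
  by (rule finite_measureI) (simp add: emeasure_restrict_space emeasure_lborel_Icc_eq)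

lemma prob_space_unit_leb: "prob_space unit_leb"
  by (rule prob_spaceI) (simp add: emeasure_restrict_space)

interpretation U: prob_space unit_leb
  by (rule prob_space_unit_leb)

lemma borel_measurable_lebesgue_on:
  fixes f :: "real \<Rightarrow> real"
  shows "f \<in> borel_measurable borel \<Longrightarrow> f \<in> borel_measurable (lebesgue_on S)"
  by (simp add: measurable_completion measurable_restrict_space1)

lemma AE_unit_leb_pos: "AE x in unit_leb. 0 < x \<and> x \<le> 1"
proof (rule AE_I)
  show "emeasure unit_leb {0} = 0"
    by (simp add: emeasure_restrict_space)
qed (auto simp: sets_restrict_space_iff)

section \<open>The distribution function of \<open>f\<close> and its quantile function\<close>

definition sublevel :: "(real \<Rightarrow> real) \<Rightarrow> real \<Rightarrow> real" where
  "sublevel f s = measure unit_leb {u \<in> {0..1}. f u \<le> s}"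

lemma sublevel_mem: "0 \<le> sublevel f s" "sublevel f s \<le> 1"
  by (auto simp: sublevel_def)

context
  fixes f :: "real \<Rightarrow> real"
  assumes f[measurable]: "f \<in> borel_measurable unit_leb"
begin

lemma sublevel_set_sets: "{u \<in> {0..1}. f u \<le> s} \<in> sets unit_leb"
  using f[unfolded borel_measurable_iff_le] by simp

lemma superlevel_set_sets: "{u \<in> {0..1}. s < f u} \<in> sets unit_leb"
  using f[unfolded borel_measurable_iff_greater] by simp

lemma integral_sublevel: "(LINT u|unit_leb. indicat_real {u. f u \<le> s} u) = sublevel f s"
proof -
  have "(LINT u|unit_leb. indicat_real {u. f u \<le> s} u)
      = (LINT u|unit_leb. indicat_real {u \<in> {0..1}. f u \<le> s} u)"
    by (intro Bochner_Integration.integral_cong) (auto simp: indicator_def)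
  then show ?thesis
    by (simp add: sublevel_def Int_absorb2 subset_iff)
qed

lemma integral_superlevel: "(LINT u|unit_leb. indicator {..<f u} s) = 1 - sublevel f s"
proof -
  have "(LINT u|unit_leb. indicator {..<f u} s)
      = (LINT u|unit_leb. indicat_real {u \<in> {0..1}. s < f u} u)"
    by (intro Bochner_Integration.integral_cong) (auto simp: indicator_def)
  also have "\<dots> = measure unit_leb ({0..1} - {u \<in> {0..1}. f u \<le> s})"
    by (simp add: Int_absorb2 subset_iff) (rule arg_cong[where f="measure _"], auto)
  also have "\<dots> = 1 - sublevel f s"
    using U.prob_compl[OF sublevel_set_sets] by (simp add: sublevel_def)
  finally show ?thesis .
qed

text \<open>Right continuity of the distribution function of \<open>f\<close>. It makes the set of
  levels in the definition of the rearrangement closed, so that a finite infimum is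
  attained.\<close>

lemma sublevel_right_limit:
  assumes "\<And>y. s < y \<Longrightarrow> x \<le> sublevel f y"
  shows "x \<le> sublevel f s"
proof -
  interpret D: real_distribution "distr unit_leb borel f"
    by (rule U.real_distribution_distr) (rule f)
  have eq: "cdf (distr unit_leb borel f) = sublevel f"
    by (auto simp: fun_eq_iff cdf_def2 measure_distr sublevel_def intro!: arg_cong[where f=U.prob])
  have "(sublevel f \<longlongrightarrow> sublevel f s) (at_right s)"
    using D.cdf_is_right_cont[of s] unfolding eq continuous_within .
  moreover have "eventually (\<lambda>y. x \<le> sublevel f y) (at_right s)"
    using assms by (auto simp: eventually_at_filter)
  ultimately show ?thesis
    by (intro tendsto_lowerbound) auto
qed

text \<open>Quantile and distribution function form a Galois connection. If the infimum is at most
  \<open>s\<close>, every \<open>y > s\<close> lies above an admissible level and is itself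
  admissible, and right continuity passes to \<open>s\<close>; conversely \<open>s\<close> is then
  one of the levels. Values in the extended reals absorb the cases of an infimum -\<infinity> or
  \<infinity>.\<close>

lemma increasing_rearrangement_le_iff:
  "increasing_rearrangement f x \<le> ereal s \<longleftrightarrow> x \<le> sublevel f s"
proof
  assume le: "increasing_rearrangement f x \<le> ereal s"
  show "x \<le> sublevel f s"
  proof (rule sublevel_right_limit)
    fix y assume "s < y"
    with le have "increasing_rearrangement f x < ereal y"
      by (simp add: le_less_trans)
    then obtain z where z: "x \<le> sublevel f z" "z < y"
      unfolding increasing_rearrangement_def integral_sublevel INF_less_iff by auto
    have "sublevel f z \<le> sublevel f y"
      unfolding sublevel_def using z(2)
      by (intro U.finite_measure_mono sublevel_set_sets) auto
    with z(1) show "x \<le> sublevel f y" by simp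
  qed
next
  assume "x \<le> sublevel f s"
  then show "increasing_rearrangement f x \<le> ereal s"
    unfolding increasing_rearrangement_def integral_sublevel by (auto intro: INF_lower)
qed

context
  fixes B :: real
  assumes fB: "f \<in> {0..1} \<rightarrow> {-B..B}"
begin

text \<open>Up to the null point 0, the superlevel set of the rearrangement at level
  \<open>s\<close> is therefore the interval to the right of \<open>sublevel f s\<close>, the form
  that the bathtub principle requires.\<close>

lemma less_real_rearrangement_iff:
  assumes "0 < x" "x \<le> 1"
  shows "s < real_rearrangement f x \<longleftrightarrow> sublevel f s < x"
proof -
  have "\<bar>increasing_rearrangement f x\<bar> \<noteq> \<infinity>"
    by (rule increasing_rearrangement_finite[OF _ fB assms]) simp
  then have "increasing_rearrangement f x = ereal (real_rearrangement f x)"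
    by (simp add: real_rearrangement_def ereal_real')
  then show ?thesis
    using increasing_rearrangement_le_iff[of x s] by auto
qed

text \<open>The infimum is -\<infinity> here, and \<open>real_of_ereal\<close> sends it to its
  default 0. The value matters because bounds and measurability are claimed on the closed
  interval.\<close>

lemma real_rearrangement_0: "real_rearrangement f 0 = 0"
proof -
  have "increasing_rearrangement f 0 \<le> ereal s" for s
    by (simp add: increasing_rearrangement_le_iff sublevel_mem)
  then have "increasing_rearrangement f 0 = - \<infinity>"
    by (rule ereal_bot)
  then show ?thesis
    by (simp add: real_rearrangement_def)
qed

lemma real_rearrangement_bounds: "real_rearrangement f \<in> {0..1} \<rightarrow> {-B..B}"
proof
  fix x :: real assume x: "x \<in> {0..1}"
  \<comment> \<open>Any point would do: the aim is \<open>0 \<le> B\<close>, so that the default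
    value 0 lies in the range.\<close>
  have "f 0 \<in> {-B..B}" using fB by auto
  then have B: "-B \<le> 0" "0 \<le> B" by auto
  show "real_rearrangement f x \<in> {-B..B}"
  proof (cases "x = 0")
    case True
    with B show ?thesis by (simp add: real_rearrangement_0)
  next
    case False
    with x have x01: "0 < x" "x \<le> 1" by auto
    have "{u \<in> {0..1}. f u \<le> B} = {0..1}" using fB by auto
    then have "sublevel f B = 1"
      using U.prob_space by (simp add: sublevel_def)
    then have "real_rearrangement f x \<le> B"
      using less_real_rearrangement_iff[OF x01, of B] x01 by simp
    moreover have "-B \<le> real_rearrangement f x"
    proof (rule dense_le)
      fix s assume "s < -B"
      then have "{u \<in> {0..1}. f u \<le> s} = {}" using fB by force
      then have "sublevel f s = 0" by (simp only: sublevel_def measure_empty)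
      then show "s \<le> real_rearrangement f x"
        using less_real_rearrangement_iff[OF x01, of s] x01 by simp
    qed
    ultimately show ?thesis by simp
  qed
qed

lemma borel_measurable_real_rearrangement: "real_rearrangement f \<in> borel_measurable unit_leb"
  unfolding borel_measurable_iff_greater
proof
  fix s
  \<comment> \<open>The point 0 is treated apart: with its default value 0 it belongs to the
    superlevel set exactly when \<open>s < 0\<close>.\<close>
  have "{x \<in> space unit_leb. s < real_rearrangement f x}
      = {x \<in> {0..1}. sublevel f s < x \<or> (x = 0 \<and> s < 0)}"
    using less_real_rearrangement_iff[of _ s] sublevel_mem(1)[of f s]
    by (auto simp: real_rearrangement_0 order_le_less)
  also have "\<dots> = {sublevel f s<..1} \<union> (if s < 0 then {0} else {})"
    using sublevel_mem(1)[of f s] by auto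
  also have "\<dots> \<in> sets unit_leb"
    using sublevel_mem(1)[of f s] by (auto simp: sets_restrict_space_iff)
  finally show "{x \<in> space unit_leb. s < real_rearrangement f x} \<in> sets unit_leb" .
qed

end

end

section \<open>The bathtub principle for a decreasing integrand\<close>

lemma bathtub:
  fixes G w :: "real \<Rightarrow> real"
  assumes G: "integrable unit_leb G" "antimono_on {0..1} G"
    and w: "w \<in> borel_measurable unit_leb" "w \<in> {0..1} \<rightarrow> {0..1}"
    and m: "0 \<le> m" "m \<le> 1" "(LINT x|unit_leb. w x) = 1 - m"
  shows "(LINT x|unit_leb. G x * indicator {m<..} x) \<le> (LINT x|unit_leb. G x * w x)"
proof -
  have [measurable]: "G \<in> borel_measurable unit_leb"
    using G(1) by (rule borel_measurable_integrable)
  have iw: "integrable unit_leb w"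
    using w by (intro U.integrable_const_bound[where B=1] AE_I2) (auto simp: Pi_iff)
  have iGw: "integrable unit_leb (\<lambda>x. G x * w x)"
    using w by (intro Bochner_Integration.integrable_bound[OF G(1)] AE_I2)
      (auto simp: abs_mult Pi_iff intro!: mult_left_le)
  have mm: "indicat_real {m<..} \<in> borel_measurable unit_leb"
    by (intro borel_measurable_lebesgue_on) simp
  have ii: "integrable unit_leb (indicat_real {m<..})"
    by (intro U.integrable_const_bound[where B=1] mm) auto
  have iGi: "integrable unit_leb (\<lambda>x. G x * indicat_real {m<..} x)"
    using mm by (intro Bochner_Integration.integrable_bound[OF G(1)])
      (auto simp: abs_mult intro!: mult_left_le)
  have "(LINT x|unit_leb. indicat_real {m<..} x) = (LINT x|unit_leb. indicat_real {m<..1} x)"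
    by (intro Bochner_Integration.integral_cong) (auto simp: indicator_def)
  also have "\<dots> = 1 - m"
    using m by (simp add: measure_restrict_space Int_absorb2 subset_iff)
  finally have im: "(LINT x|unit_leb. indicat_real {m<..} x) = 1 - m" .
  \<comment> \<open>Both factors change sign at \<open>m\<close>: beyond it
    \<open>G x \<le> G m\<close> and \<open>w x \<le> 1\<close>, up to it
    \<open>G m \<le> G x\<close> and \<open>0 \<le> w x\<close>. Subtracting the constant
    \<open>G m\<close> changes nothing in the comparison, since both weights have mass
    \<open>1 - m\<close>.\<close>
  have "0 \<le> (LINT x|unit_leb. (G x - G m) * (w x - indicator {m<..} x))"
  proof (rule integral_nonneg_AE, rule AE_I2)
    fix x assume "x \<in> space unit_leb"
    then have x: "x \<in> {0..1}" by simp
    then have wx: "0 \<le> w x" "w x \<le> 1" using w(2) by auto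
    show "0 \<le> (G x - G m) * (w x - indicator {m<..} x)"
    proof (cases "m < x")
      case True
      then have "G x \<le> G m" using G(2) x m unfolding monotone_on_def by auto
      with True wx show ?thesis by (simp add: mult_nonpos_nonpos)
    next
      case False
      then have "G m \<le> G x" using G(2) x m unfolding monotone_on_def by auto
      with False wx show ?thesis by simp
    qed
  qed
  also have "\<dots> = (LINT x|unit_leb. (G x * w x - G x * indicator {m<..} x)
      - G m * (w x - indicator {m<..} x))"
    by (simp add: algebra_simps)
  also have "\<dots> = (LINT x|unit_leb. G x * w x) - (LINT x|unit_leb. G x * indicator {m<..} x)"
    using iw iGw ii iGi m(3) im by simp
  finally show ?thesis by simp
qed

section \<open>The power of the absolute value and its derivative\<close>

lemma powr_abs_has_derivative:
  fixes p u :: real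
  assumes "1 \<le> p" "p = 1 \<Longrightarrow> u \<noteq> 0"
  shows "((\<lambda>u. \<bar>u\<bar> powr p) has_real_derivative sgn u * (p * \<bar>u\<bar> powr (p - 1))) (at u)"
proof -
  consider "0 < u" | "u < 0" | "u = 0" "1 < p" using assms by linarith
  then show ?thesis
  proof cases
    case 1
    have "((\<lambda>u. u powr p) has_real_derivative p * u powr (p - 1)) (at u)"
      using 1 by (rule has_real_derivative_powr)
    moreover have "eventually (\<lambda>x. 0 < x) (nhds u)"
      using 1 by (intro eventually_nhds_in_open[of "{0<..}", simplified]) auto
    then have "eventually (\<lambda>x. x powr p = \<bar>x\<bar> powr p) (nhds u)"
      by eventually_elim simp
    ultimately show ?thesis
      using 1 by (subst (asm) DERIV_cong_ev[OF refl _ refl]) auto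
  next
    case 2
    have "((\<lambda>u. (-u) powr p) has_real_derivative - (p * (-u) powr (p - 1))) (at u)"
      using 2 by (auto intro!: derivative_eq_intros)
    moreover have "eventually (\<lambda>x. x < 0) (nhds u)"
      using 2 by (intro eventually_nhds_in_open[of "{..<0}", simplified]) auto
    then have "eventually (\<lambda>x. (-x) powr p = \<bar>x\<bar> powr p) (nhds u)"
      by eventually_elim simp
    ultimately show ?thesis
      using 2 by (subst (asm) DERIV_cong_ev[OF refl _ refl]) auto
  next
    case 3
    \<comment> \<open>At 0 the difference quotient has modulus
      \<open>\<bar>h\<bar> powr (p - 1)\<close>, which vanishes in the limit because
      \<open>1 < p\<close>; this agrees with the formula since \<open>sgn 0 = 0\<close>.\<close>
    have "((\<lambda>h. \<bar>h\<bar> powr (p - 1)) \<longlongrightarrow> \<bar>0\<bar> powr (p - 1)) (at (0::real))"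
      using 3 by (intro tendsto_powr' tendsto_rabs tendsto_ident_at tendsto_const) auto
    then have "((\<lambda>h. \<bar>h\<bar> powr (p - 1)) \<longlongrightarrow> 0) (at (0::real))"
      by simp
    then have "((\<lambda>h. \<bar>h\<bar> powr p / h) \<longlongrightarrow> 0) (at (0::real))"
    proof (rule Lim_null_comparison[rotated])
      show "eventually (\<lambda>h. norm (\<bar>h\<bar> powr p / h) \<le> \<bar>h\<bar> powr (p - 1)) (at (0::real))"
        by (auto simp: eventually_at_filter powr_diff abs_divide)
    qed
    with 3 show ?thesis
      by (simp add: DERIV_def)
  qed
qed

lemma continuous_on_powr_abs: "0 < p \<Longrightarrow> continuous_on UNIV (\<lambda>u::real. \<bar>u\<bar> powr p)"
  by (intro continuous_on_powr' continuous_intros) auto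

lemma mono_powr_abs_deriv:
  fixes p :: real
  assumes "1 \<le> p"
  shows "mono (\<lambda>u. sgn u * (p * \<bar>u\<bar> powr (p - 1)))"
proof (rule monoI)
  fix u v :: real assume "u \<le> v"
  consider "0 < u" | "u \<le> 0" "0 \<le> v" | "v < 0" by linarith
  then show "sgn u * (p * \<bar>u\<bar> powr (p - 1)) \<le> sgn v * (p * \<bar>v\<bar> powr (p - 1))"
  proof cases
    case 1
    with \<open>u \<le> v\<close> assms show ?thesis by (simp add: powr_mono2)
  next
    case 2
    then have "sgn u * (p * \<bar>u\<bar> powr (p - 1)) \<le> 0" "0 \<le> sgn v * (p * \<bar>v\<bar> powr (p - 1))"
      using assms by (auto simp: sgn_if)
    then show ?thesis by linarith
  next
    case 3
    with \<open>u \<le> v\<close> assms show ?thesis by (simp add: powr_mono2)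
  qed
qed

text \<open>Strict convexity of the cost, the source of the positivity of \<open>eta\<close>. At
  \<open>p = 1\<close> the derivative is \<open>sgn\<close>, which is only weakly monotone.\<close>

lemma powr_abs_deriv_strict:
  fixes p u v :: real
  assumes "1 < p" "u < v"
  shows "sgn u * (p * \<bar>u\<bar> powr (p - 1)) < sgn v * (p * \<bar>v\<bar> powr (p - 1))"
proof -
  consider "0 \<le> u" | "u < 0" "0 \<le> v" | "v < 0" by linarith
  then show ?thesis
  proof cases
    case 1
    then have "u powr (p - 1) < v powr (p - 1)"
      using assms by (intro powr_less_mono2) auto
    with 1 assms show ?thesis by (cases "u = 0") auto
  next
    case 2
    then have "sgn u * (p * \<bar>u\<bar> powr (p - 1)) < 0" "0 \<le> sgn v * (p * \<bar>v\<bar> powr (p - 1))"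
      using assms by (auto simp: sgn_if)
    then show ?thesis by linarith
  next
    case 3
    then have "(-v) powr (p - 1) < (-u) powr (p - 1)"
      using assms by (intro powr_less_mono2) auto
    with 3 assms show ?thesis by simp
  qed
qed

section \<open>The gain from exchanging two wrongly ordered values, and positivity of
  \<open>eta\<close>\<close>

definition swap_gain :: "(real \<Rightarrow> real) \<Rightarrow> real \<Rightarrow> real \<Rightarrow> real \<Rightarrow> real \<Rightarrow> real" where
  "swap_gain \<phi> v v' t t' = \<phi> (v - t') + \<phi> (v' - t) - \<phi> (v - t) - \<phi> (v' - t')"

text \<open>For \<open>t < t'\<close> the map sending \<open>s\<close> to
  \<open>\<bar>s - t\<bar> powr p - \<bar>s - t'\<bar> powr p\<close> has positive derivative by
  strict convexity. Comparing its values at \<open>v\<close> and \<open>v'\<close> gives the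
  claim.\<close>

lemma swap_gain_powr_pos:
  fixes p :: real
  assumes "1 < p" "v < v'" "t < t'"
  shows "0 < swap_gain (\<lambda>u. \<bar>u\<bar> powr p) v v' t t'"
proof -
  let ?g = "\<lambda>u::real. sgn u * (p * \<bar>u\<bar> powr (p - 1))"
  have "\<bar>v - t\<bar> powr p - \<bar>v - t'\<bar> powr p < \<bar>v' - t\<bar> powr p - \<bar>v' - t'\<bar> powr p"
  proof (rule DERIV_pos_imp_increasing[OF \<open>v < v'\<close>])
    fix s
    have D: "((\<lambda>s. \<bar>s - r\<bar> powr p) has_real_derivative ?g (s - r) * 1) (at s)" for r
      using assms
      by (intro DERIV_chain2[of "\<lambda>u. \<bar>u\<bar> powr p", OF powr_abs_has_derivative])
        (auto intro!: derivative_eq_intros)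
    show "\<exists>y. ((\<lambda>s. \<bar>s - t\<bar> powr p - \<bar>s - t'\<bar> powr p) has_real_derivative y) (at s) \<and> 0 < y"
      using DERIV_diff[OF D[of t] D[of t']] powr_abs_deriv_strict[of p "s - t'" "s - t"] assms
      by (intro exI[of _ "?g (s - t) * 1 - ?g (s - t') * 1"]) simp
  qed
  then show ?thesis by (simp add: swap_gain_def)
qed

lemma continuous_on_swap_gain:
  assumes "continuous_on UNIV \<phi>"
  shows "continuous_on UNIV (\<lambda>(v, v', t, t'). swap_gain \<phi> v v' t t')"
  unfolding swap_gain_def case_prod_beta
  by (intro continuous_intros continuous_on_compose2[OF assms]) auto

text \<open>Presents \<open>eta\<close> as the infimum of one continuous function over a region of
  four-dimensional space, so that compactness and closure arguments apply.\<close>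

lemma eta_eq:
  "eta K \<epsilon> p = Inf ((\<lambda>(v, v', t, t'). swap_gain (\<lambda>u. \<bar>u\<bar> powr p) v v' t t') `
     {(v, v', t, t') \<in> K \<times> K \<times> K \<times> K. v' \<ge> v + \<epsilon> \<and> t' \<ge> t + \<epsilon>})"
  unfolding eta_def swap_gain_def by (rule arg_cong[where f=Inf], simp add: image_def Bex_def) blast

context
  fixes K :: "real set" and \<epsilon> p :: real
  assumes K: "bounded K" and \<epsilon>: "0 < \<epsilon>" and p: "1 < p"
begin

text \<open>A real \<open>Inf\<close> is known to be a lower bound once the set is bounded below;
  positivity of the swap gain supplies the bound 0.\<close>

lemma eta_le_swap_gain:
  assumes "v \<in> K" "v' \<in> K" "t \<in> K" "t' \<in> K" "v' \<ge> v + \<epsilon>" "t' \<ge> t + \<epsilon>"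
  shows "eta K \<epsilon> p \<le> swap_gain (\<lambda>u. \<bar>u\<bar> powr p) v v' t t'"
  unfolding eta_eq
proof (rule cInf_lower)
  show "bdd_below ((\<lambda>(v, v', t, t'). swap_gain (\<lambda>u. \<bar>u\<bar> powr p) v v' t t') `
     {(v, v', t, t') \<in> K \<times> K \<times> K \<times> K. v' \<ge> v + \<epsilon> \<and> t' \<ge> t + \<epsilon>})"
    using \<epsilon> p by (intro bdd_belowI[of _ 0]) (auto intro!: less_imp_le swap_gain_powr_pos)
qed (rule image_eqI[of _ _ "(v, v', t, t')"], use assms in auto)

text \<open>An infimum of positive numbers may be 0. Replacing \<open>K\<close> by its closure makes
  the constraint region compact, so the minimum over it is attained at a point still satisfying the
  constraints, where the gain is positive. The given quadruple shows that the region is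
  nonempty.\<close>

lemma eta_pos:
  assumes "v \<in> K" "v' \<in> K" "t \<in> K" "t' \<in> K" "v' \<ge> v + \<epsilon>" "t' \<ge> t + \<epsilon>"
  shows "0 < eta K \<epsilon> p"
proof -
  let ?h = "\<lambda>(v, v', t, t'). swap_gain (\<lambda>u. \<bar>u\<bar> powr p) v v' t t'"
  define S where "S = {(v, v', t, t') \<in> K \<times> K \<times> K \<times> K. v' \<ge> v + \<epsilon> \<and> t' \<ge> t + \<epsilon>}"
  define C where "C = {x :: real \<times> real \<times> real \<times> real. fst (snd x) \<ge> fst x + \<epsilon> \<and>
    snd (snd (snd x)) \<ge> fst (snd (snd x)) + \<epsilon>}"
  let ?T = "(closure K \<times> closure K \<times> closure K \<times> closure K) \<inter> C"
  have "closed C"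
    unfolding C_def by (intro closed_Collect_conj closed_Collect_le continuous_intros)
  moreover have "compact (closure K)"
    using K by (simp add: compact_closure)
  ultimately have cT: "compact ?T"
    by (intro compact_Int_closed compact_Times)
  have ST: "S \<subseteq> ?T"
    using closure_subset[of K] by (auto simp: S_def C_def)
  have "(v, v', t, t') \<in> S"
    using assms by (auto simp: S_def)
  then have S_ne: "S \<noteq> {}" by auto
  with ST have "?T \<noteq> {}" by blast
  moreover have "continuous_on ?T ?h"
    using p by (intro continuous_on_subset[OF continuous_on_swap_gain] continuous_on_powr_abs) auto
  ultimately have "\<exists>m\<in>?T. \<forall>x\<in>?T. ?h m \<le> ?h x"
    by (rule continuous_attains_inf[OF cT])
  then obtain m where m: "m \<in> ?T" "\<forall>x\<in>?T. ?h m \<le> ?h x" ..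
  obtain a b c d where abcd: "m = (a, b, c, d)"
    by (cases m) auto
  with m(1) have "a + \<epsilon> \<le> b" "c + \<epsilon> \<le> d"
    by (simp_all add: C_def)
  with \<epsilon> p have "0 < ?h m"
    unfolding abcd prod.case by (intro swap_gain_powr_pos) linarith+
  also have "?h m \<le> eta K \<epsilon> p"
    unfolding eta_eq S_def[symmetric]
  proof (rule cInf_greatest)
    show "?h ` S \<noteq> {}" using S_ne by simp
  next
    fix y assume "y \<in> ?h ` S"
    then show "?h m \<le> y"
      by (rule imageE) (simp only: bspec[OF m(2) subsetD[OF ST]])
  qed
  finally show ?thesis .
qed

text \<open>The bound is a closed condition, so it extends from a product set to its closure. This
  serves for suprema and infima of values, which may lie outside \<open>K\<close>.\<close>

lemma eta_le_swap_gain_closure: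
  assumes "V \<subseteq> K" "V' \<subseteq> K" "T \<subseteq> K" "T' \<subseteq> K"
    and V: "\<And>v v'. v \<in> V \<Longrightarrow> v' \<in> V' \<Longrightarrow> v' \<ge> v + \<epsilon>"
    and T: "\<And>t t'. t \<in> T \<Longrightarrow> t' \<in> T' \<Longrightarrow> t' \<ge> t + \<epsilon>"
    and "v \<in> closure V" "v' \<in> closure V'" "t \<in> closure T" "t' \<in> closure T'"
  shows "eta K \<epsilon> p \<le> swap_gain (\<lambda>u. \<bar>u\<bar> powr p) v v' t t'"
proof -
  let ?h = "\<lambda>(v, v', t, t'). swap_gain (\<lambda>u. \<bar>u\<bar> powr p) v v' t t'"
  have "closed {x. eta K \<epsilon> p \<le> ?h x}"
    using p by (intro closed_Collect_le continuous_on_const continuous_on_swap_gain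
        continuous_on_powr_abs) auto
  moreover have "V \<times> V' \<times> T \<times> T' \<subseteq> {x. eta K \<epsilon> p \<le> ?h x}"
    using assms by (auto intro!: eta_le_swap_gain)
  ultimately have "closure (V \<times> V' \<times> T \<times> T') \<subseteq> {x. eta K \<epsilon> p \<le> ?h x}"
    by (rule closure_minimal[rotated])
  moreover have "(v, v', t, t') \<in> closure (V \<times> V' \<times> T \<times> T')"
    using assms by (simp add: closure_Times)
  ultimately have "(v, v', t, t') \<in> {x. eta K \<epsilon> p \<le> ?h x}"
    by (rule subsetD)
  then show ?thesis by simp
qed

end

section \<open>Convex costs given by a nondecreasing \<open>g\<close> and its primitive; the layer
  cake formula\<close>

locale convex_primitive =
  fixes \<phi> g :: "real \<Rightarrow> real"
  assumes mono_deriv: "mono g"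
    and cont: "continuous_on UNIV \<phi>"
    and primitive: "a \<le> b \<Longrightarrow> (g has_integral (\<phi> b - \<phi> a)) {a..b}"
begin

lemma deriv_measurable [measurable]: "g \<in> borel_measurable borel"
  using mono_deriv by (rule borel_measurable_mono)

lemma cost_measurable [measurable]: "\<phi> \<in> borel_measurable borel"
  using cont by (rule borel_measurable_continuous_onI)

lemma deriv_bounded:
  assumes "\<bar>x\<bar> \<le> C"
  shows "\<bar>g x\<bar> \<le> \<bar>g C\<bar> + \<bar>g (-C)\<bar>"
proof -
  have "g (-C) \<le> g x" "g x \<le> g C"
    using assms by (auto intro!: monoD[OF mono_deriv])
  then show ?thesis by linarith
qed

text \<open>The layer cake formula at a single point. The indicator turns an integral up to
  \<open>v\<close> into one over a fixed interval, which prepares the exchange of integrals.\<close>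

lemma integral_deriv:
  assumes v: "v \<in> {-B..B}" and t: "t \<in> {-B..B}"
  shows "integrable (lebesgue_on {-B..B}) (\<lambda>s. g (s - t) * indicator {..<v} s)"
    and "(LINT s|lebesgue_on {-B..B}. g (s - t) * indicator {..<v} s) = \<phi> (v - t) - \<phi> (-B - t)"
proof -
  interpret S: finite_measure "lebesgue_on {-B..B}"
    by (rule finite_measure_lebesgue_on_Icc)
  \<comment> \<open>Both \<open>s\<close> and \<open>t\<close> lie in \<open>{-B..B}\<close>, hence
    \<open>\<bar>s - t\<bar> \<le> 2 * B\<close>.\<close>
  have "\<bar>g (s - t)\<bar> \<le> \<bar>g (2 * B)\<bar> + \<bar>g (- (2 * B))\<bar>" if "s \<in> {-B..B}" for s
    using that t by (intro deriv_bounded) auto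
  then show int: "integrable (lebesgue_on {-B..B}) (\<lambda>s. g (s - t) * indicator {..<v} s)"
    by (intro S.integrable_const_bound[where B="\<bar>g (2 * B)\<bar> + \<bar>g (- (2 * B))\<bar>"] AE_I2
        borel_measurable_lebesgue_on) (auto simp: indicator_def)
  have "((\<lambda>s. g (s - t)) has_integral (\<phi> (v - t) - \<phi> (-B - t))) {-B..v}"
    using has_integral_shift_real_ivl[OF primitive[of "-B - t" "v - t"], of "-t"] v by simp
  then have "((\<lambda>s. if s \<in> {-B..v} then g (s - t) else 0) has_integral
      (\<phi> (v - t) - \<phi> (-B - t))) {-B..B}"
    using v by (subst has_integral_restrict) auto
  \<comment> \<open>The indicator of \<open>{..<v}\<close> leaves out the endpoint \<open>v\<close>,
    a single point.\<close>
  then have "((\<lambda>s. g (s - t) * indicator {..<v} s) has_integral (\<phi> (v - t) - \<phi> (-B - t))) {-B..B}"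
    by (rule has_integral_spike_finite[of "{v}", rotated 2]) (auto simp: indicator_def)
  then show "(LINT s|lebesgue_on {-B..B}. g (s - t) * indicator {..<v} s)
      = \<phi> (v - t) - \<phi> (-B - t)"
    using lebesgue_integral_eq_integral[OF int] by (simp add: integral_unique)
qed

lemma integrable_cost:
  assumes "f \<in> borel_measurable unit_leb" "h \<in> borel_measurable unit_leb"
    and "f \<in> {0..1} \<rightarrow> {-B..B}" "h \<in> {0..1} \<rightarrow> {-B..B}"
  shows "integrable unit_leb (\<lambda>x. \<phi> (f x - h x))"
proof -
  have "compact (\<phi> ` {-(2 * B)..2 * B})"
    by (intro compact_continuous_image continuous_on_subset[OF cont]) auto
  then obtain C where C: "\<forall>u\<in>{-(2 * B)..2 * B}. \<bar>\<phi> u\<bar> \<le> C"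
    using compact_imp_bounded[of "\<phi> ` {-(2 * B)..2 * B}"] by (auto simp: bounded_real)
  have "\<bar>\<phi> (f x - h x)\<bar> \<le> C" if "x \<in> {0..1}" for x
  proof (rule bspec[OF C])
    have "f x \<in> {-B..B}" "h x \<in> {-B..B}" using assms that by auto
    then show "f x - h x \<in> {-(2 * B)..2 * B}" by auto
  qed
  then show ?thesis
    using assms(1,2) by (intro U.integrable_const_bound[where B=C] AE_I2) auto
qed

text \<open>The contribution of the level \<open>s\<close> to the cost. At fixed \<open>s\<close> it
  depends on \<open>f\<close> only through the set where \<open>f\<close> exceeds
  \<open>s\<close>.\<close>

definition slice :: "(real \<Rightarrow> real) \<Rightarrow> (real \<Rightarrow> real) \<Rightarrow> real \<Rightarrow> real" where
  "slice f0 f s = (LINT x|unit_leb. g (s - f0 x) * indicator {..<f x} s)"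

text \<open>Integrates the pointwise formula over \<open>x\<close> and exchanges the integrals;
  Fubini applies because the integrand is bounded on a finite product measure. The term with
  \<open>-B\<close> does not involve \<open>f\<close>.\<close>

lemma layer_cake:
  assumes f [measurable]: "f \<in> borel_measurable unit_leb"
    and f0 [measurable]: "f0 \<in> borel_measurable unit_leb"
    and fB: "f \<in> {0..1} \<rightarrow> {-B..B}" and f0B: "f0 \<in> {0..1} \<rightarrow> {-B..B}"
  shows "integrable (lebesgue_on {-B..B}) (slice f0 f)"
    and "(LINT x|unit_leb. \<phi> (f x - f0 x))
      = (LINT x|unit_leb. \<phi> (-B - f0 x)) + (LINT s|lebesgue_on {-B..B}. slice f0 f s)"
proof -
  interpret S: finite_measure "lebesgue_on {-B..B}"
    by (rule finite_measure_lebesgue_on_Icc)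
  interpret P: pair_sigma_finite "lebesgue_on {-B..B}" unit_leb
    by (intro pair_sigma_finite.intro S.sigma_finite_measure_axioms U.sigma_finite_measure_axioms)
  interpret SU: finite_measure "lebesgue_on {-B..B} \<Otimes>\<^sub>M unit_leb"
    by (rule finite_measure_pair_measure) unfold_locales
  let ?F = "\<lambda>s x. g (s - f0 x) * indicator {..<f x} s"
  let ?C = "\<bar>g (2 * B)\<bar> + \<bar>g (- (2 * B))\<bar>"
  have f0x: "f0 x \<in> {-B..B}" and fx: "f x \<in> {-B..B}" if "x \<in> {0..1}" for x
    using f0B fB that by auto
  have bd: "\<bar>g (s - f0 x)\<bar> \<le> ?C" if "s \<in> {-B..B}" "x \<in> {0..1}" for s x
    using that(1) f0x[OF that(2)] by (intro deriv_bounded) auto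
  have [measurable]: "(\<lambda>s. s) \<in> borel_measurable (lebesgue_on {-B..B})"
    by (intro borel_measurable_lebesgue_on) simp
  have meas: "case_prod ?F \<in> borel_measurable (lebesgue_on {-B..B} \<Otimes>\<^sub>M unit_leb)"
    unfolding indicator_def lessThan_iff by measurable
  have int: "integrable (lebesgue_on {-B..B} \<Otimes>\<^sub>M unit_leb) (case_prod ?F)"
    using bd by (intro SU.integrable_const_bound[where B="?C"] AE_I2 meas)
      (auto simp: indicator_def space_pair_measure)
  show "integrable (lebesgue_on {-B..B}) (slice f0 f)"
    unfolding slice_def using P.integrable_fst'[OF int] by simp
  have B0: "0 \<le> B" using fx[of 0] by simp
  then have Bm: "(\<lambda>_. -B) \<in> {0..1::real} \<rightarrow> {-B..B}" by auto
  have "(LINT s|lebesgue_on {-B..B}. slice f0 f s)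
      = (LINT x|unit_leb. LINT s|lebesgue_on {-B..B}. ?F s x)"
    unfolding slice_def by (rule P.Fubini_integral[OF int, symmetric])
  also have "\<dots> = (LINT x|unit_leb. \<phi> (f x - f0 x) - \<phi> (-B - f0 x))"
    using fx f0x by (intro Bochner_Integration.integral_cong integral_deriv) auto
  also have "\<dots> = (LINT x|unit_leb. \<phi> (f x - f0 x)) - (LINT x|unit_leb. \<phi> (-B - f0 x))"
    by (intro Bochner_Integration.integral_diff integrable_cost[where B=B] f f0 fB f0B Bm) auto
  finally show "(LINT x|unit_leb. \<phi> (f x - f0 x))
      = (LINT x|unit_leb. \<phi> (-B - f0 x)) + (LINT s|lebesgue_on {-B..B}. slice f0 f s)"
    by simp
qed

section \<open>The cost of the rearrangement compared with the cost of \<open>f\<close>\<close>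

context
  fixes f f0 :: "real \<Rightarrow> real" and B :: real
  assumes f [measurable]: "f \<in> borel_measurable unit_leb"
    and f0 [measurable]: "f0 \<in> borel_measurable unit_leb"
    and fB: "f \<in> {0..1} \<rightarrow> {-B..B}" and f0B: "f0 \<in> {0..1} \<rightarrow> {-B..B}"
    and f0_mono: "mono_on {0..1} f0"
begin

lemma integrable_deriv_target: "integrable unit_leb (\<lambda>x. g (s - f0 x))"
proof -
  let ?C = "\<bar>g (\<bar>s\<bar> + B)\<bar> + \<bar>g (- (\<bar>s\<bar> + B))\<bar>"
  have "\<bar>g (s - f0 x)\<bar> \<le> ?C" if "x \<in> {0..1}" for x
  proof (rule deriv_bounded)
    have "f0 x \<in> {-B..B}" using f0B that by auto
    then show "\<bar>s - f0 x\<bar> \<le> \<bar>s\<bar> + B" by auto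
  qed
  then show ?thesis
    by (intro U.integrable_const_bound[where B="?C"] AE_I2) auto
qed

lemma integrable_deriv_times:
  assumes [measurable]: "w \<in> borel_measurable unit_leb" and "w \<in> {0..1} \<rightarrow> {0..1}"
  shows "integrable unit_leb (\<lambda>x. g (s - f0 x) * w x)"
  using assms(2) by (intro Bochner_Integration.integrable_bound[OF integrable_deriv_target] AE_I2)
    (auto simp: abs_mult Pi_iff intro!: mult_left_le)

text \<open>The bathtub principle at level \<open>s\<close>: \<open>g (s - f0 x)\<close> decreases
  in \<open>x\<close>, and \<open>w\<close> has the mass of the superlevel set. The weight is kept
  general because the improved bound tests with one that is not the superlevel indicator of
  \<open>f\<close>.\<close>

lemma slice_rearrangement_le:
  assumes w: "w \<in> borel_measurable unit_leb" "w \<in> {0..1} \<rightarrow> {0..1}"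
    and eq: "(LINT x|unit_leb. w x) = (LINT x|unit_leb. indicator {..<f x} s)"
  shows "slice f0 (real_rearrangement f) s \<le> (LINT x|unit_leb. g (s - f0 x) * w x)"
proof -
  have "slice f0 (real_rearrangement f) s
      = (LINT x|unit_leb. g (s - f0 x) * indicator {sublevel f s<..} x)"
    unfolding slice_def
  proof (rule integral_cong_AE)
    show "AE x in unit_leb. g (s - f0 x) * indicator {..<real_rearrangement f x} s
        = g (s - f0 x) * indicator {sublevel f s<..} x"
      using AE_unit_leb_pos
      by eventually_elim (simp add: indicator_def less_real_rearrangement_iff[OF f fB])
    have [measurable]: "real_rearrangement f \<in> borel_measurable unit_leb"
      by (rule borel_measurable_real_rearrangement[OF f fB])
    show "(\<lambda>x. g (s - f0 x) * indicator {..<real_rearrangement f x} s) \<in> borel_measurable unit_leb"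
      unfolding indicator_def lessThan_iff by measurable
    have [measurable]: "indicat_real {sublevel f s<..} \<in> borel_measurable unit_leb"
      by (intro borel_measurable_lebesgue_on) simp
    show "(\<lambda>x. g (s - f0 x) * indicator {sublevel f s<..} x) \<in> borel_measurable unit_leb"
      by measurable
  qed
  also have "\<dots> \<le> (LINT x|unit_leb. g (s - f0 x) * w x)"
  proof (rule bathtub[OF integrable_deriv_target _ w sublevel_mem])
    show "antimono_on {0..1} (\<lambda>x. g (s - f0 x))"
      using f0_mono by (auto simp: monotone_on_def intro!: monoD[OF mono_deriv])
    show "(LINT x|unit_leb. w x) = 1 - sublevel f s"
      unfolding eq by (rule integral_superlevel[OF f])
  qed
  finally show ?thesis .
qed

text \<open>Integrates a comparison made level by level; the common term with \<open>-B\<close>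
  cancels. Here \<open>e\<close> is the gain at each level: 0 for the plain inequality, the surplus
  of the swap for the improved one.\<close>

lemma cost_rearrangement_le:
  assumes e: "integrable (lebesgue_on {-B..B}) e"
    and le: "\<And>s. s \<in> {-B..B} \<Longrightarrow> slice f0 (real_rearrangement f) s + e s \<le> slice f0 f s"
  shows "(LINT x|unit_leb. \<phi> (real_rearrangement f x - f0 x)) + (LINT s|lebesgue_on {-B..B}. e s)
    \<le> (LINT x|unit_leb. \<phi> (f x - f0 x))"
proof -
  note lc = layer_cake[OF f f0 fB f0B]
  note lcr = layer_cake[OF borel_measurable_real_rearrangement[OF f fB] f0
      real_rearrangement_bounds[OF f fB] f0B]
  have "(LINT s|lebesgue_on {-B..B}. slice f0 (real_rearrangement f) s)
        + (LINT s|lebesgue_on {-B..B}. e s)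
      = (LINT s|lebesgue_on {-B..B}. slice f0 (real_rearrangement f) s + e s)"
    using lcr(1) e by simp
  also have "\<dots> \<le> (LINT s|lebesgue_on {-B..B}. slice f0 f s)"
    using lc(1) lcr(1) e le by (intro integral_mono) auto
  finally show ?thesis
    unfolding lc(2) lcr(2) by simp
qed

lemma superlevel_weight:
  "(\<lambda>x. indicat_real {..<f x} s) \<in> borel_measurable unit_leb"
  "(\<lambda>x. indicat_real {..<f x} s) \<in> {0..1} \<rightarrow> {0..1}"
proof -
  show "(\<lambda>x. indicat_real {..<f x} s) \<in> borel_measurable unit_leb"
    unfolding indicator_def lessThan_iff by measurable
qed (auto simp: indicator_def)

lemma slice_rearrangement_le_slice: "slice f0 (real_rearrangement f) s \<le> slice f0 f s"
  unfolding slice_def[of f0 f] by (rule slice_rearrangement_le[OF superlevel_weight refl])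

lemma cost_rearrangement_mono:
  "(LINT x|unit_leb. \<phi> (real_rearrangement f x - f0 x)) \<le> (LINT x|unit_leb. \<phi> (f x - f0 x))"
  using cost_rearrangement_le[of "\<lambda>_. 0"] slice_rearrangement_le_slice by simp

text \<open>The test weight takes mass \<open>\<delta>\<close> from \<open>A\<close>, inside the
  superlevel set, and puts it on \<open>A'\<close>, outside it. By monotonicity of \<open>g\<close>
  the integrand is at least \<open>g (s - c)\<close> on \<open>A\<close> and at most
  \<open>g (s - d)\<close> on \<open>A'\<close>, which bounds the gain.\<close>

lemma slice_rearrangement_swap:
  assumes A: "A \<in> sets unit_leb" "A' \<in> sets unit_leb" "A \<inter> A' = {}"
    and \<delta>: "0 < \<delta>" "\<delta> \<le> measure unit_leb A" "\<delta> \<le> measure unit_leb A'"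
    and fA: "\<And>x. x \<in> A \<Longrightarrow> s < f x" and fA': "\<And>x. x \<in> A' \<Longrightarrow> f x \<le> s"
    and c: "\<And>x. x \<in> A \<Longrightarrow> f0 x \<le> c" and d: "\<And>x. x \<in> A' \<Longrightarrow> d \<le> f0 x"
  shows "slice f0 (real_rearrangement f) s + \<delta> * (g (s - c) - g (s - d)) \<le> slice f0 f s"
proof -
  \<comment> \<open>Spreading the mass uniformly with these fractions replaces a choice of subsets
    of measure exactly \<open>\<delta>\<close>.\<close>
  define \<alpha> where "\<alpha> = \<delta> / measure unit_leb A"
  define \<beta> where "\<beta> = \<delta> / measure unit_leb A'"
  have pos: "0 < measure unit_leb A" "0 < measure unit_leb A'"
    using \<delta> by auto
  have ab: "0 \<le> \<alpha>" "\<alpha> \<le> 1" "0 \<le> \<beta>" "\<beta> \<le> 1"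
    "\<alpha> * measure unit_leb A = \<delta>" "\<beta> * measure unit_leb A' = \<delta>"
    using \<delta> pos by (auto simp: \<alpha>_def \<beta>_def)
  define w where "w = (\<lambda>x. indicat_real {..<f x} s - \<alpha> * indicat_real A x + \<beta> * indicat_real A' x)"
  note [measurable] = superlevel_weight(1) A(1,2)
  have AB: "A \<subseteq> {0..1}" "A' \<subseteq> {0..1}"
    using A(1,2)[THEN sets.sets_into_space] by auto
  have iA: "(LINT x|unit_leb. indicat_real A x) = measure unit_leb A"
    "(LINT x|unit_leb. indicat_real A' x) = measure unit_leb A'"
    using AB by (simp_all add: Int_absorb2)
  have iS: "integrable unit_leb (\<lambda>x. indicat_real {..<f x} s)"
    by (rule U.integrable_const_bound[where B=1]) auto
  have ii: "integrable unit_leb (indicat_real A)" "integrable unit_leb (indicat_real A')"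
    by (auto intro!: U.integrable_const_bound[where B=1])
  have w_meas: "w \<in> borel_measurable unit_leb"
    unfolding w_def by measurable
  have w_range: "w \<in> {0..1} \<rightarrow> {0..1}"
  proof
    fix x show "w x \<in> {0..1}"
    proof (cases "x \<in> A")
      case True
      with A(3) have "x \<notin> A'" by auto
      with True fA[OF True] ab show ?thesis by (simp add: w_def)
    next
      case False
      with fA'[of x] ab show ?thesis
        by (cases "x \<in> A'") (auto simp: w_def indicator_def)
    qed
  qed
  have w_int: "(LINT x|unit_leb. w x) = (LINT x|unit_leb. indicator {..<f x} s)"
    unfolding w_def using iS ii iA ab by simp
  have gA: "integrable unit_leb (\<lambda>x. g (s - f0 x) * indicator A x)"
    "integrable unit_leb (\<lambda>x. g (s - f0 x) * indicator A' x)"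
    by (auto intro!: integrable_deriv_times)
  have gS: "integrable unit_leb (\<lambda>x. g (s - f0 x) * indicator {..<f x} s)"
    by (rule integrable_deriv_times[OF superlevel_weight])
  have "g (s - c) * measure unit_leb A = (LINT x|unit_leb. g (s - c) * indicator A x)"
    using iA by simp
  also have "\<dots> \<le> (LINT x|unit_leb. g (s - f0 x) * indicator A x)"
    using c by (intro integral_mono gA integrable_mult_right ii)
      (auto simp: indicator_def intro!: monoD[OF mono_deriv])
  finally have lowA: "g (s - c) * measure unit_leb A \<le> (LINT x|unit_leb. g (s - f0 x) * indicator A x)" .
  have "(LINT x|unit_leb. g (s - f0 x) * indicator A' x) \<le> (LINT x|unit_leb. g (s - d) * indicator A' x)"
    using d by (intro integral_mono gA integrable_mult_right ii)
      (auto simp: indicator_def intro!: monoD[OF mono_deriv])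
  also have "\<dots> = g (s - d) * measure unit_leb A'"
    using iA by simp
  finally have upA': "(LINT x|unit_leb. g (s - f0 x) * indicator A' x) \<le> g (s - d) * measure unit_leb A'" .
  have "slice f0 (real_rearrangement f) s \<le> (LINT x|unit_leb. g (s - f0 x) * w x)"
    by (rule slice_rearrangement_le[OF w_meas w_range w_int])
  also have "\<dots> = (LINT x|unit_leb. g (s - f0 x) * indicator {..<f x} s
      - \<alpha> * (g (s - f0 x) * indicator A x) + \<beta> * (g (s - f0 x) * indicator A' x))"
    by (simp add: w_def algebra_simps)
  also have "\<dots> = slice f0 f s - \<alpha> * (LINT x|unit_leb. g (s - f0 x) * indicator A x)
      + \<beta> * (LINT x|unit_leb. g (s - f0 x) * indicator A' x)"
    unfolding slice_def using gS gA by simp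
  also have "\<dots> \<le> slice f0 f s - \<alpha> * (g (s - c) * measure unit_leb A)
      + \<beta> * (g (s - d) * measure unit_leb A')"
    using mult_left_mono[OF lowA ab(1)] mult_left_mono[OF upA' ab(3)] by linarith
  also have "\<dots> = slice f0 f s - g (s - c) * (\<alpha> * measure unit_leb A)
      + g (s - d) * (\<beta> * measure unit_leb A')"
    by (simp add: ac_simps)
  finally show ?thesis
    unfolding ab by (simp add: algebra_simps)
qed

text \<open>The swap is admissible at each level \<open>s\<close> with \<open>b \<le> s\<close> and
  \<open>s < a\<close>. Its gains, integrated over these levels, add up to \<open>\<delta>\<close>
  times the swap gain.\<close>

lemma cost_rearrangement_swap:
  assumes A: "A \<in> sets unit_leb" "A' \<in> sets unit_leb"
    and \<delta>: "0 < \<delta>" "\<delta> \<le> measure unit_leb A" "\<delta> \<le> measure unit_leb A'"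
    and ba: "-B \<le> b" "b < a" "a \<le> B" and cd: "c \<in> {-B..B}" "d \<in> {-B..B}"
    and fA: "\<And>x. x \<in> A \<Longrightarrow> a \<le> f x" and fA': "\<And>x. x \<in> A' \<Longrightarrow> f x \<le> b"
    and c: "\<And>x. x \<in> A \<Longrightarrow> f0 x \<le> c" and d: "\<And>x. x \<in> A' \<Longrightarrow> d \<le> f0 x"
  shows "(LINT x|unit_leb. \<phi> (real_rearrangement f x - f0 x)) + \<delta> * swap_gain \<phi> b a c d
    \<le> (LINT x|unit_leb. \<phi> (f x - f0 x))"
proof -
  have disj: "A \<inter> A' = {}"
    using fA fA' ba(2) by fastforce
  \<comment> \<open>The layer cake integrand: \<open>k t a s - k t b s\<close> equals
    \<open>g (s - t)\<close> for \<open>b \<le> s < a\<close> and 0 at the other levels, while its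
    integral is known from \<open>integral_deriv\<close>.\<close>
  define k where "k = (\<lambda>t v s. g (s - t) * indicat_real {..<v} s)"
  have ab: "a \<in> {-B..B}" "b \<in> {-B..B}" using ba by auto
  have int: "integrable (lebesgue_on {-B..B}) (k t v)"
    and val: "integral\<^sup>L (lebesgue_on {-B..B}) (k t v) = \<phi> (v - t) - \<phi> (-B - t)"
    if "v \<in> {-B..B}" "t \<in> {-B..B}" for t v
    unfolding k_def using integral_deriv[OF that] by simp_all
  let ?e = "\<lambda>s. \<delta> * ((k c a s - k c b s) - (k d a s - k d b s))"
  have "(LINT s|lebesgue_on {-B..B}. ?e s) = \<delta> * swap_gain \<phi> b a c d"
    using int[OF ab(1) cd(1)] int[OF ab(1) cd(2)] int[OF ab(2) cd(1)] int[OF ab(2) cd(2)]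
    by (simp add: val[OF ab(1) cd(1)] val[OF ab(1) cd(2)] val[OF ab(2) cd(1)] val[OF ab(2) cd(2)]
        swap_gain_def)
  moreover have "(LINT x|unit_leb. \<phi> (real_rearrangement f x - f0 x))
      + (LINT s|lebesgue_on {-B..B}. ?e s) \<le> (LINT x|unit_leb. \<phi> (f x - f0 x))"
  proof (rule cost_rearrangement_le)
    show "integrable (lebesgue_on {-B..B}) ?e"
      using int[OF ab(1) cd(1)] int[OF ab(1) cd(2)] int[OF ab(2) cd(1)] int[OF ab(2) cd(2)]
      by simp
    fix s
    show "slice f0 (real_rearrangement f) s + ?e s \<le> slice f0 f s"
    proof (cases "b \<le> s \<and> s < a")
      case True
      then have "slice f0 (real_rearrangement f) s + \<delta> * (g (s - c) - g (s - d)) \<le> slice f0 f s"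
        using fA fA' by (intro slice_rearrangement_swap[OF A disj \<delta>] c d) fastforce+
      with True show ?thesis by (simp add: k_def)
    next
      case False
      then have e0: "?e s = 0" using ba(2) by (auto simp: k_def indicator_def)
      show ?thesis unfolding e0 using slice_rearrangement_le_slice by simp
    qed
  qed
  ultimately show ?thesis by (simp only:)
qed

end

end

section \<open>The two families of costs: powers and excesses over a threshold\<close>

lemma convex_primitive_powr:
  fixes p :: real
  assumes "1 \<le> p"
  shows "convex_primitive (\<lambda>u. \<bar>u\<bar> powr p) (\<lambda>u. sgn u * (p * \<bar>u\<bar> powr (p - 1)))"
proof
  show "mono (\<lambda>u. sgn u * (p * \<bar>u\<bar> powr (p - 1)))"
    using assms by (rule mono_powr_abs_deriv)
  show cont: "continuous_on UNIV (\<lambda>u. \<bar>u\<bar> powr p)"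
    using assms by (intro continuous_on_powr_abs) simp
  show "((\<lambda>u. sgn u * (p * \<bar>u\<bar> powr (p - 1))) has_integral (\<bar>b\<bar> powr p - \<bar>a\<bar> powr p)) {a..b}"
    if "a \<le> b" for a b :: real
  \<comment> \<open>At \<open>p = 1\<close> the cost has a kink at 0. An integral identity, unlike a
    derivative at every point, tolerates this exceptional point.\<close>
  proof (rule fundamental_theorem_of_calculus_strong[of "{0}" a b "\<lambda>u. \<bar>u\<bar> powr p"])
    show "((\<lambda>u. \<bar>u\<bar> powr p) has_vector_derivative sgn x * (p * \<bar>x\<bar> powr (p - 1))) (at x)"
      if "x \<in> {a..b} - {0}" for x
      using that assms
      by (auto simp: has_real_derivative_iff_has_vector_derivative[symmetric]
          intro!: powr_abs_has_derivative)
  qed (use that in \<open>auto intro: continuous_on_subset[OF cont]\<close>)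
qed

text \<open>The integral of this cost vanishes exactly when the error is almost everywhere at most
  \<open>r\<close>, which turns bounds on the essential supremum into comparisons of
  integrals.\<close>

lemma convex_primitive_excess:
  fixes r :: real
  assumes "0 \<le> r"
  shows "convex_primitive (\<lambda>u. max (\<bar>u\<bar> - r) 0) (\<lambda>u. if r < u then 1 else if u < -r then -1 else 0)"
    (is "convex_primitive ?\<phi> ?g")
proof
  show "mono ?g"
    using assms by (auto intro!: monoI)
  show cont: "continuous_on UNIV ?\<phi>"
    by (intro continuous_intros)
  show "(?g has_integral (?\<phi> b - ?\<phi> a)) {a..b}" if "a \<le> b" for a b :: real
  proof (rule fundamental_theorem_of_calculus_strong[of "{-r, r}" a b ?\<phi>])
    fix x assume x: "x \<in> {a..b} - {-r, r}"
    then consider "r < x" | "x < -r" | "-r < x" "x < r" by fastforce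
    then have "(?\<phi> has_real_derivative ?g x) (at x)"
    proof cases
      case 1
      have "((\<lambda>u. u - r) has_real_derivative 1) (at x)"
        by (auto intro!: derivative_eq_intros)
      then have "(?\<phi> has_real_derivative 1) (at x)"
        by (rule has_field_derivative_transform_within_open[of _ _ _ "{r<..}"])
          (use 1 assms in auto)
      with 1 assms show ?thesis by simp
    next
      case 2
      have "((\<lambda>u. - u - r) has_real_derivative -1) (at x)"
        by (auto intro!: derivative_eq_intros)
      then have "(?\<phi> has_real_derivative -1) (at x)"
        by (rule has_field_derivative_transform_within_open[of _ _ _ "{..<-r}"])
          (use 2 assms in auto)
      with 2 assms show ?thesis by simp
    next
      case 3
      have "((\<lambda>u. 0) has_real_derivative 0) (at x)"
        by simp
      then have "(?\<phi> has_real_derivative 0) (at x)"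
        by (rule has_field_derivative_transform_within_open[of _ _ _ "{-r<..<r}"])
          (use 3 assms in auto)
      with 3 show ?thesis by simp
    qed
    then show "(?\<phi> has_vector_derivative ?g x) (at x)"
      by (simp add: has_real_derivative_iff_has_vector_derivative)
  qed (use that in \<open>auto intro: continuous_on_subset[OF cont]\<close>)
qed

section \<open>Comparison of the norms, and the improved bound for powers\<close>

context
  fixes f f0 :: "real \<Rightarrow> real" and B :: real
  assumes f [measurable]: "f \<in> borel_measurable unit_leb"
    and f0 [measurable]: "f0 \<in> borel_measurable unit_leb"
    and fB: "f \<in> {0..1} \<rightarrow> {-B..B}" and f0B: "f0 \<in> {0..1} \<rightarrow> {-B..B}"
    and f0_mono: "mono_on {0..1} f0"
begin

lemma esssup_rearrangement_le:
  "esssup unit_leb (\<lambda>x. ereal \<bar>real_rearrangement f x - f0 x\<bar>)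
    \<le> esssup unit_leb (\<lambda>x. ereal \<bar>f x - f0 x\<bar>)"
proof (rule ereal_le_real)
  fix r assume r: "esssup unit_leb (\<lambda>x. ereal \<bar>f x - f0 x\<bar>) \<le> ereal r"
  have [measurable]: "real_rearrangement f \<in> borel_measurable unit_leb"
    by (rule borel_measurable_real_rearrangement[OF f fB])
  have ae: "AE x in unit_leb. \<bar>f x - f0 x\<bar> \<le> r"
    using esssup_AE[of "\<lambda>x. ereal \<bar>f x - f0 x\<bar>" unit_leb]
    by eventually_elim (use r in \<open>metis ereal_less_eq(3) order_trans\<close>)
  \<comment> \<open>The measure is not null, so a constant statement holding almost everywhere is
    true.\<close>
  then have "AE x in unit_leb. 0 \<le> r"
    by eventually_elim linarith
  then have r0: "0 \<le> r" by (simp only: U.AE_const)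
  interpret E: convex_primitive "\<lambda>u. max (\<bar>u\<bar> - r) 0"
      "\<lambda>u. if r < u then 1 else if u < -r then -1 else 0"
    using r0 by (rule convex_primitive_excess)
  have int: "integrable unit_leb (\<lambda>x. max (\<bar>real_rearrangement f x - f0 x\<bar> - r) 0)"
    by (rule E.integrable_cost[OF _ f0 real_rearrangement_bounds[OF f fB] f0B]) measurable
  have "(LINT x|unit_leb. max (\<bar>real_rearrangement f x - f0 x\<bar> - r) 0)
      \<le> (LINT x|unit_leb. max (\<bar>f x - f0 x\<bar> - r) 0)"
    by (rule E.cost_rearrangement_mono[OF f f0 fB f0B f0_mono])
  also have "\<dots> = 0"
    by (rule integral_eq_zero_AE) (use ae in \<open>eventually_elim, simp\<close>)
  finally have "(LINT x|unit_leb. max (\<bar>real_rearrangement f x - f0 x\<bar> - r) 0) = 0"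
    by (intro antisym integral_nonneg_AE) auto
  then have "AE x in unit_leb. max (\<bar>real_rearrangement f x - f0 x\<bar> - r) 0 = 0"
    by (subst (asm) integral_nonneg_eq_0_iff_AE[OF int]) auto
  then have "AE x in unit_leb. ereal \<bar>real_rearrangement f x - f0 x\<bar> \<le> ereal r"
    by eventually_elim (simp add: max_def split: if_splits)
  then show "esssup unit_leb (\<lambda>x. ereal \<bar>real_rearrangement f x - f0 x\<bar>) \<le> ereal r"
    by (rule esssup_I[rotated]) measurable
qed

lemma Lp_norm_rearrangement_le:
  assumes "1 \<le> p"
  shows "Lp_norm p (\<lambda>x. real_rearrangement f x - f0 x) \<le> Lp_norm p (\<lambda>x. f x - f0 x)"
proof (cases p)
  case (real q)
  then have q: "1 \<le> q" using assms by simp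
  interpret P: convex_primitive "\<lambda>u. \<bar>u\<bar> powr q" "\<lambda>u. sgn u * (q * \<bar>u\<bar> powr (q - 1))"
    using q by (rule convex_primitive_powr)
  have "(LINT x|unit_leb. \<bar>real_rearrangement f x - f0 x\<bar> powr q)
      \<le> (LINT x|unit_leb. \<bar>f x - f0 x\<bar> powr q)"
    by (rule P.cost_rearrangement_mono[OF f f0 fB f0B f0_mono])
  with q show ?thesis
    by (simp add: Lp_norm_def real powr_mono2)
qed (use assms esssup_rearrangement_le in \<open>auto simp: Lp_norm_def\<close>)

lemma powr_integral_rearrangement_gain:
  assumes K: "bounded K" "f \<in> {0..1} \<rightarrow> K" "f0 \<in> {0..1} \<rightarrow> K"
    and pos: "0 < \<delta>" "0 < \<epsilon>" "1 < p"
    and A: "A \<in> sets unit_leb" "\<delta> < measure unit_leb A"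
    and A': "A' \<in> sets unit_leb" "\<delta> < measure unit_leb A'"
    and sep: "\<And>x x'. x \<in> A \<Longrightarrow> x' \<in> A' \<Longrightarrow> f x > f x' + \<epsilon> \<and> f0 x' > f0 x + \<epsilon>"
  shows "0 < eta K \<epsilon> p"
    and "(LINT x|unit_leb. \<bar>real_rearrangement f x - f0 x\<bar> powr p) + \<delta> * eta K \<epsilon> p
      \<le> (LINT x|unit_leb. \<bar>f x - f0 x\<bar> powr p)"
proof -
  have sub: "A \<subseteq> {0..1}" "A' \<subseteq> {0..1}"
    using sets.sets_into_space[OF A(1)] sets.sets_into_space[OF A'(1)] by simp_all
  have ne: "A \<noteq> {}" "A' \<noteq> {}"
    using A(2) A'(2) pos(1) by auto
  \<comment> \<open>One point of each set yields the quadruple of values in \<open>K\<close> that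
    \<open>eta_pos\<close> asks for.\<close>
  then obtain x x' where x: "x \<in> A" "x' \<in> A'" by blast
  then show "0 < eta K \<epsilon> p"
    using sep[OF x] K(2,3) sub
    by (intro eta_pos[OF K(1) pos(2,3), of "f x'" "f x" "f0 x" "f0 x'"]) (auto simp: less_imp_le)
  interpret P: convex_primitive "\<lambda>u. \<bar>u\<bar> powr p" "\<lambda>u. sgn u * (p * \<bar>u\<bar> powr (p - 1))"
    using pos by (intro convex_primitive_powr) simp
  have range: "f ` A \<subseteq> {-B..B}" "f ` A' \<subseteq> {-B..B}" "f0 ` A \<subseteq> {-B..B}" "f0 ` A' \<subseteq> {-B..B}"
    using fB f0B sub by auto
  have bdd: "bdd_below (f ` A)" "bdd_above (f ` A')" "bdd_above (f0 ` A)" "bdd_below (f0 ` A')"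
    by (rule bdd_below_mono[OF bdd_below_Icc range(1)] bdd_above_mono[OF bdd_above_Icc range(2)]
        bdd_above_mono[OF bdd_above_Icc range(3)] bdd_below_mono[OF bdd_below_Icc range(4)])+
  \<comment> \<open>The worst values: \<open>f\<close> is at least \<open>a\<close> and
    \<open>f0\<close> at most \<open>c\<close> on \<open>A\<close>, while \<open>f\<close> is at
    most \<open>b\<close> and \<open>f0\<close> at least \<open>d\<close> on \<open>A'\<close>. They
    lie in the closures of the images.\<close>
  define a where "a = Inf (f ` A)"
  define b where "b = Sup (f ` A')"
  define c where "c = Sup (f0 ` A)"
  define d where "d = Inf (f0 ` A')"
  have cl: "a \<in> closure (f ` A)" "b \<in> closure (f ` A')" "c \<in> closure (f0 ` A)" "d \<in> closure (f0 ` A')"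
    using ne bdd by (auto simp: a_def b_def c_def d_def intro!: closure_contains_Inf closure_contains_Sup)
  have "closure S \<subseteq> {-B..B}" if "S \<subseteq> {-B..B}" for S
    using that by (rule closure_minimal) simp
  then have mem: "a \<in> {-B..B}" "b \<in> {-B..B}" "c \<in> {-B..B}" "d \<in> {-B..B}"
    using cl range by blast+
  \<comment> \<open>The uniform gap \<open>\<epsilon>\<close> survives the passage to supremum and
    infimum, so \<open>b < a\<close> remains strict.\<close>
  have "b \<le> f x - \<epsilon>" if "x \<in> A" for x
    unfolding b_def using ne(2) sep[OF that] by (intro cSUP_least) (auto simp: less_eq_real_def algebra_simps)
  then have "b + \<epsilon> \<le> a"
    unfolding a_def using ne(1) by (intro cINF_greatest) (auto simp: algebra_simps)
  with pos(2) have ba: "b < a" by simp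
  have "\<delta> * eta K \<epsilon> p \<le> \<delta> * swap_gain (\<lambda>u. \<bar>u\<bar> powr p) b a c d"
  proof (rule mult_left_mono)
    show "eta K \<epsilon> p \<le> swap_gain (\<lambda>u. \<bar>u\<bar> powr p) b a c d"
      \<comment> \<open>The low values of \<open>f\<close> come from \<open>A'\<close> and the high
        ones from \<open>A\<close>; for \<open>f0\<close> it is the reverse.\<close>
      using cl K(2,3) sub sep
      by (intro eta_le_swap_gain_closure[OF K(1) pos(2,3),
            where V="f ` A'" and V'="f ` A" and T="f0 ` A" and T'="f0 ` A'"])
        (auto simp: less_imp_le)
  qed (use pos in simp)
  moreover have "(LINT x|unit_leb. \<bar>real_rearrangement f x - f0 x\<bar> powr p)
      + \<delta> * swap_gain (\<lambda>u. \<bar>u\<bar> powr p) b a c d \<le> (LINT x|unit_leb. \<bar>f x - f0 x\<bar> powr p)"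
  proof (rule P.cost_rearrangement_swap[OF f f0 fB f0B f0_mono A(1) A'(1) pos(1)])
    show "a \<le> f x" "f0 x \<le> c" if "x \<in> A" for x
      using that bdd by (auto simp: a_def c_def intro!: cINF_lower cSUP_upper)
    show "f x \<le> b" "d \<le> f0 x" if "x \<in> A'" for x
      using that bdd by (auto simp: b_def d_def intro!: cINF_lower cSUP_upper)
  qed (use A A' mem ba in auto)
  ultimately show "(LINT x|unit_leb. \<bar>real_rearrangement f x - f0 x\<bar> powr p) + \<delta> * eta K \<epsilon> p
      \<le> (LINT x|unit_leb. \<bar>f x - f0 x\<bar> powr p)"
    by linarith
qed

end

text \<open>The difference under the root is nonnegative because it dominates the integral for the
  rearrangement; stating this makes the \<open>powr\<close> on the right a genuine root.\<close>

theorem proposition1: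
  fixes K :: "real set" and f0 fhat :: "real \<Rightarrow> real"
  assumes "bounded K"
    and "f0 \<in> {0..1} \<rightarrow> K"
    and "f0 \<in> borel_measurable unit_leb"
    and "mono_on {0..1} f0"
    and "fhat \<in> {0..1} \<rightarrow> K"
    and "fhat \<in> borel_measurable unit_leb"
  shows
    "(\<forall>p::ereal. 1 \<le> p \<longrightarrow>
        Lp_norm p (\<lambda>x. real_rearrangement fhat x - f0 x) \<le> Lp_norm p (\<lambda>x. fhat x - f0 x)) \<and>
     (\<forall>(\<delta>::real) (\<epsilon>::real) X0 X0'.
        \<delta> > 0 \<and> \<epsilon> > 0 \<and>
        X0 \<in> sets unit_leb \<and> X0' \<in> sets unit_leb \<and>
        measure unit_leb X0 > \<delta> \<and> measure unit_leb X0' > \<delta> \<and>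
        (\<forall>x\<in>X0. \<forall>x'\<in>X0'. x' > x \<and> fhat x > fhat x' + \<epsilon> \<and> f0 x' > f0 x + \<epsilon>) \<longrightarrow>
        (\<forall>p::real. 1 < p \<longrightarrow>
           eta K \<epsilon> p > 0 \<and>
           (LINT x|unit_leb. \<bar>fhat x - f0 x\<bar> powr p) - \<delta> * eta K \<epsilon> p \<ge> 0 \<and>
           Lp_norm (ereal p) (\<lambda>x. real_rearrangement fhat x - f0 x)
             \<le> ereal (((LINT x|unit_leb. \<bar>fhat x - f0 x\<bar> powr p) - \<delta> * eta K \<epsilon> p) powr (1 / p))))"
proof -
  obtain B where "\<And>k. k \<in> K \<Longrightarrow> \<bar>k\<bar> \<le> B"
    using assms(1) by (auto simp: bounded_real)
  then have "K \<subseteq> {-B..B}" by (fastforce simp: abs_le_iff)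
  then have B: "fhat \<in> {0..1} \<rightarrow> {-B..B}" "f0 \<in> {0..1} \<rightarrow> {-B..B}"
    using assms(2,5) by auto
  note regular = assms(6,3) B assms(4)
  show ?thesis
  proof (intro conjI allI impI; (elim conjE)?)
    fix p :: ereal assume "1 \<le> p"
    with regular show "Lp_norm p (\<lambda>x. real_rearrangement fhat x - f0 x) \<le> Lp_norm p (\<lambda>x. fhat x - f0 x)"
      by (rule Lp_norm_rearrangement_le)
  next
    fix \<delta> \<epsilon> p :: real and X0 X0'
    assume "\<delta> > 0" "\<epsilon> > 0" "1 < p" "X0 \<in> sets unit_leb" "X0' \<in> sets unit_leb"
      "measure unit_leb X0 > \<delta>" "measure unit_leb X0' > \<delta>"
      "\<forall>x\<in>X0. \<forall>x'\<in>X0'. x' > x \<and> fhat x > fhat x' + \<epsilon> \<and> f0 x' > f0 x + \<epsilon>"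
    note gain = powr_integral_rearrangement_gain[OF regular assms(1,5,2) this(1,2,3,4,6,5,7)]
      and sep = this(8)
    have eta: "0 < eta K \<epsilon> p"
      by (rule gain(1)) (use sep in auto)
    have le: "(LINT x|unit_leb. \<bar>real_rearrangement fhat x - f0 x\<bar> powr p)
        \<le> (LINT x|unit_leb. \<bar>fhat x - f0 x\<bar> powr p) - \<delta> * eta K \<epsilon> p"
      unfolding le_diff_eq by (rule gain(2)) (use sep in auto)
    have nonneg: "0 \<le> (LINT x|unit_leb. \<bar>real_rearrangement fhat x - f0 x\<bar> powr p)"
      by simp
    show "eta K \<epsilon> p > 0" by (rule eta)
    show "(LINT x|unit_leb. \<bar>fhat x - f0 x\<bar> powr p) - \<delta> * eta K \<epsilon> p \<ge> 0"
      using le nonneg by linarith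
    show "Lp_norm (ereal p) (\<lambda>x. real_rearrangement fhat x - f0 x)
        \<le> ereal (((LINT x|unit_leb. \<bar>fhat x - f0 x\<bar> powr p) - \<delta> * eta K \<epsilon> p) powr (1 / p))"
      using le \<open>1 < p\<close> by (simp add: Lp_norm_def powr_mono2)
  qed
qed

end
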